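(* The following configurations of vortices on the unit sphere are fixed equilibria (critical points of the Hamiltonian $H$): - an equatorial $(\pm)$ring, i.e. $2N$ vortices ($N\ge 2$) placed at the vertices of a regular $2N$-gon on the equator, with vorticities alternately $+1$ and $-1$; - a regular tetrahedron (inscribed in the sphere) formed of $4$ vortices of vorticity $+1$ together with its dual tetrahedron formed of $4$ vortices of vorticity $-1$.
   Context: Vortices $x_1,\dots,x_{2N}$ on the unit sphere $S^2\subset\mathbb{R}^3$, $N$ of them with vorticity $\lambda_i=+1$ and $N$ with vorticity $\lambda_i=-1$; phase space $\mathcal{P}=\{(x_1,\dots,x_{2N})\in (S^2)^{2N}: x_i\ne x_j \text{ if } i\ne j\}$. The Hamiltonian is $H=\sum_{i<j}\lambda_i\lambda_j\ln\|x_i-x_j\|^2$, and the equations of motion are $\dot x_i=\sum_{j\ne i}\lambda_j\,\frac{x_j\times x_i}{1-x_i\cdot x_j}$. A fixed equilibrium is a critical point of $H$ on $\mathcal{P}$ (equivalently an equilibrium of the equations of motion). The dual tetrahedron is the antipodal one, with vertices at the (radially projected) face centres. *)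

theory Defs
  imports "HOL-Analysis.Analysis"
begin

text \<open>
  A configuration of \<open>2 * N\<close> vortices is a function \<open>x :: nat \<Rightarrow> real ^ 3\<close> of which only the values
  on the labels \<open>{1..2 * N}\<close> matter; likewise for the vorticities \<open>l :: nat \<Rightarrow> real\<close>.
\<close>

definition vorticities :: "nat \<Rightarrow> (nat \<Rightarrow> real) \<Rightarrow> bool" where
  "vorticities N l \<longleftrightarrow>
     (\<forall>i\<in>{1..2 * N}. l i = 1 \<or> l i = -1) \<and>
     card {i \<in> {1..2 * N}. l i = 1} = N \<and>
     card {i \<in> {1..2 * N}. l i = -1} = N"

definition phase_space :: "nat \<Rightarrow> (nat \<Rightarrow> real ^ 3) set" where
  "phase_space N =
     {x. (\<forall>i\<in>{1..2 * N}. x i \<in> sphere 0 1) \<and>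
         (\<forall>i\<in>{1..2 * N}. \<forall>j\<in>{1..2 * N}. i \<noteq> j \<longrightarrow> x i \<noteq> x j)}"

definition hamiltonian :: "nat \<Rightarrow> (nat \<Rightarrow> real) \<Rightarrow> (nat \<Rightarrow> real ^ 3) \<Rightarrow> real" where
  "hamiltonian N l x =
     (\<Sum>i = 1..2 * N. \<Sum>j\<in>{i<..2 * N}. l i * l j * ln ((norm (x i - x j))\<^sup>2))"

text \<open>
  The phase space is a submanifold of a power of the unit sphere. A point of it is critical for a
  function \<open>F\<close> if the differential of \<open>F\<close> vanishes on every tangent vector, where tangent vectors
  are represented as velocities of curves in the phase space.
\<close>

definition critical_point ::
    "nat \<Rightarrow> ((nat \<Rightarrow> real ^ 3) \<Rightarrow> real) \<Rightarrow> (nat \<Rightarrow> real ^ 3) \<Rightarrow> bool" where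
  "critical_point N F x \<longleftrightarrow>
     x \<in> phase_space N \<and>
     (\<forall>c :: real \<Rightarrow> nat \<Rightarrow> real ^ 3.
        c 0 = x \<longrightarrow> (\<forall>t. c t \<in> phase_space N) \<longrightarrow>
        (\<forall>i\<in>{1..2 * N}. (\<lambda>t. c t i) differentiable (at 0)) \<longrightarrow>
        ((\<lambda>t. F (c t)) has_real_derivative 0) (at 0))"

definition fixed_equilibrium :: "nat \<Rightarrow> (nat \<Rightarrow> real) \<Rightarrow> (nat \<Rightarrow> real ^ 3) \<Rightarrow> bool" where
  "fixed_equilibrium N l x \<longleftrightarrow> critical_point N (hamiltonian N l) x"

definition equator_point :: "real \<Rightarrow> real ^ 3" where
  "equator_point a = vector [cos a, sin a, 0]"

text \<open>
  The bijection \<open>p\<close> lists the labels in the cyclic order in which the vortices occur along the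
  equator; \<open>a\<close> is the longitude of the first listed vortex, which has vorticity \<open>1\<close>.
\<close>

definition equatorial_pm_ring :: "nat \<Rightarrow> (nat \<Rightarrow> real) \<Rightarrow> (nat \<Rightarrow> real ^ 3) \<Rightarrow> bool" where
  "equatorial_pm_ring N l x \<longleftrightarrow>
     (\<exists>a p. bij_betw p {..<2 * N} {1..2 * N} \<and>
        (\<forall>k<2 * N. x (p k) = equator_point (a + 2 * pi * real k / real (2 * N)) \<and>
                    l (p k) = (-1) ^ k))"

definition regular_tetrahedron_on_sphere :: "(real ^ 3) set \<Rightarrow> bool" where
  "regular_tetrahedron_on_sphere T \<longleftrightarrow>
     T \<subseteq> sphere 0 1 \<and> card T = 4 \<and>
     (\<exists>d. \<forall>u\<in>T. \<forall>v\<in>T. u \<noteq> v \<longrightarrow> dist u v = d)"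

definition dual_tetrahedron :: "(real ^ 3) set \<Rightarrow> (real ^ 3) set" where
  "dual_tetrahedron T = uminus ` T"

definition tetrahedron_and_dual :: "(nat \<Rightarrow> real) \<Rightarrow> (nat \<Rightarrow> real ^ 3) \<Rightarrow> bool" where
  "tetrahedron_and_dual l x \<longleftrightarrow>
     (\<exists>T. regular_tetrahedron_on_sphere T \<and>
        bij_betw x {i \<in> {1..8}. l i = 1} T \<and>
        bij_betw x {i \<in> {1..8}. l i = -1} (dual_tetrahedron T))"

end

theory Submission
  imports Defs
begin

text \<open>
  Along a curve of configurations in which vortex \<open>i\<close> has velocity \<open>v i\<close>, each \<open>v i\<close> is orthogonal
  to \<open>x i\<close>, so the derivative of the Hamiltonian splits into one term per vortex: \<open>-2 * l i\<close> times
  the sum of \<open>l j * (v i \<bullet> x j) / (dist (x i) (x j))\<^sup>2\<close> over the other vortices \<open>j\<close>. A configuration is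
  thus an equilibrium as soon as at every vortex these sums vanish in all tangent directions
  (\<open>fixed_equilibrium_if_balanced\<close>), and for both configurations this is a matter of symmetry.

  For the ring, a direction \<open>v\<close> tangent at the vortex of longitude \<open>\<alpha>\<close> satisfies
  \<open>v \<bullet> x j = C * sin s\<close> for a vortex \<open>x j\<close> of longitude \<open>\<alpha> + s\<close>, while the squared distance is
  \<open>2 - 2 * cos s\<close>. The summands are odd in \<open>s\<close>, and the reflection of the ring in the meridian of the
  chosen vortex turns \<open>s\<close> into \<open>- s\<close> and preserves the vorticities, because it moves labels
  \<open>k\<close> to \<open>2 * i - k\<close> modulo the even number \<open>2 * N\<close> (\<open>alternating_sum_reflection\<close>).

  For the tetrahedron \<open>T\<close> and its dual, fix a vertex \<open>w\<close>. The other vertices of \<open>T\<close> are at one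
  distance from \<open>w\<close>, their antipodes are at another one, and the antipode of \<open>w\<close> exerts no tangential
  force. What remains in each group is a multiple of the sum of \<open>v \<bullet> u\<close> over \<open>u \<in> T - {w}\<close>, which
  vanishes because the vertices of \<open>T\<close> add up to zero (\<open>regular_tetrahedron_sum_eq_0\<close>).
\<close>

section \<open>A balance criterion for equilibria\<close>

lemma sum_pairs_eq_sum_off_diagonal:
  fixes a :: "nat \<Rightarrow> nat \<Rightarrow> real"
  shows "(\<Sum>i = 1..n. \<Sum>j\<in>{i<..n}. a i j + a j i) = (\<Sum>i = 1..n. \<Sum>j\<in>{1..n} - {i}. a i j)"
proof -
  have upper: "(\<Sum>j\<in>{i<..n}. f j) = (\<Sum>j = 1..n. if i < j then f j else 0)"
    for i and f :: "nat \<Rightarrow> real"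
    by (rule sum.mono_neutral_cong_left) auto
  have off: "(\<Sum>j\<in>{1..n} - {i}. a i j) =
      (\<Sum>j = 1..n. (if i < j then a i j else 0) + (if j < i then a i j else 0))" for i
    by (rule sum.mono_neutral_cong_left) auto
  have "(\<Sum>i = 1..n. \<Sum>j\<in>{i<..n}. a i j + a j i) =
      (\<Sum>i = 1..n. \<Sum>j = 1..n. if i < j then a i j else 0) +
      (\<Sum>i = 1..n. \<Sum>j = 1..n. if i < j then a j i else 0)"
    by (simp add: sum.distrib upper)
  also have "(\<Sum>i = 1..n. \<Sum>j = 1..n. if i < j then a j i else 0) =
      (\<Sum>i = 1..n. \<Sum>j = 1..n. if j < i then a i j else 0)"
    by (rule sum.swap)
  finally show ?thesis
    by (simp only: off sum.distrib)
qed

lemma velocity_on_sphere_orthogonal: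
  fixes g :: "real \<Rightarrow> 'a::real_inner"
  assumes "(g has_vector_derivative v) (at t)" and "\<And>s. norm (g s) = 1"
  shows "v \<bullet> g t = 0"
proof -
  have "((\<lambda>s. g s \<bullet> g s) has_derivative (\<lambda>h. g t \<bullet> (h *\<^sub>R v) + (h *\<^sub>R v) \<bullet> g t)) (at t)"
    using assms(1) unfolding has_vector_derivative_def by (intro derivative_intros)
  moreover have "(\<lambda>s. g s \<bullet> g s) = (\<lambda>_. 1)"
    using assms(2) by (simp add: dot_square_norm)
  ultimately have "(\<lambda>h. g t \<bullet> (h *\<^sub>R v) + (h *\<^sub>R v) \<bullet> g t) = (\<lambda>_. 0)"
    by (metis has_derivative_const has_derivative_unique)
  from fun_cong[OF this, of 1] show ?thesis
    by (simp add: inner_commute)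
qed

lemma ln_norm_squared_has_real_derivative:
  fixes g :: "real \<Rightarrow> 'a::real_inner"
  assumes "(g has_vector_derivative v) (at t)" and "g t \<noteq> 0"
  shows "((\<lambda>s. ln ((norm (g s))\<^sup>2)) has_real_derivative 2 * (v \<bullet> g t) / (norm (g t))\<^sup>2) (at t)"
proof -
  have "((\<lambda>s. g s \<bullet> g s) has_derivative (\<lambda>h. g t \<bullet> (h *\<^sub>R v) + (h *\<^sub>R v) \<bullet> g t)) (at t)"
    using assms(1) unfolding has_vector_derivative_def by (intro derivative_intros)
  then have "((\<lambda>s. (norm (g s))\<^sup>2) has_real_derivative 2 * (v \<bullet> g t)) (at t)"
    unfolding has_field_derivative_def power2_norm_eq_inner
    by (rule has_derivative_eq_rhs) (auto simp: inner_commute)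
  then show ?thesis
    by (auto intro!: DERIV_ln_divide[THEN DERIV_chain2, THEN DERIV_cong] simp: assms(2))
qed

text \<open>
  The balance condition says that the total force on vortex \<open>i\<close> is radial. For unit vectors the
  radial velocities \<open>v i \<bullet> x i\<close> vanish, which reduces \<open>(v i - v j) \<bullet> (x i - x j)\<close> to
  \<open>- (v i \<bullet> x j) - v j \<bullet> x i\<close>; this is what separates the velocities of different vortices.
\<close>

lemma fixed_equilibrium_if_balanced:
  assumes x: "x \<in> phase_space N"
    and balanced: "\<And>i v. i \<in> {1..2 * N} \<Longrightarrow> v \<bullet> x i = 0 \<Longrightarrow>
      (\<Sum>j\<in>{1..2 * N} - {i}. l j * (v \<bullet> x j) / (dist (x i) (x j))\<^sup>2) = 0"
  shows "fixed_equilibrium N l x"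
  unfolding fixed_equilibrium_def critical_point_def
proof (intro conjI allI impI)
  show "x \<in> phase_space N" by (fact x)
next
  fix c :: "real \<Rightarrow> nat \<Rightarrow> real ^ 3"
  assume c0: "c 0 = x" and c: "\<forall>t. c t \<in> phase_space N"
    and diff: "\<forall>i\<in>{1..2 * N}. (\<lambda>t. c t i) differentiable (at 0)"
  define v where "v i = vector_derivative (\<lambda>t. c t i) (at 0)" for i
  have v: "((\<lambda>t. c t i) has_vector_derivative v i) (at 0)" if "i \<in> {1..2 * N}" for i
    using diff that unfolding v_def by (simp add: vector_derivative_works)
  have tangent: "v i \<bullet> x i = 0" if "i \<in> {1..2 * N}" for i
    using velocity_on_sphere_orthogonal[OF v[OF that]] c that c0 by (simp add: phase_space_def)
  \<comment> \<open>The share of \<open>v i\<close> in the derivative of the interaction energy of the pair \<open>i\<close>, \<open>j\<close>.\<close>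
  define a where "a i j = - 2 * l i * (l j * (v i \<bullet> x j) / (dist (x i) (x j))\<^sup>2)" for i j
  have "((\<lambda>t. l i * l j * ln ((norm (c t i - c t j))\<^sup>2)) has_real_derivative a i j + a j i) (at 0)"
    if ij: "i \<in> {1..2 * N}" "j \<in> {i<..2 * N}" for i j
  proof -
    have j: "j \<in> {1..2 * N}" and ne: "x i \<noteq> x j"
      using ij x by (auto simp: phase_space_def)
    have "((\<lambda>t. c t i - c t j) has_vector_derivative v i - v j) (at 0)"
      using v ij(1) j by (intro derivative_intros)
    then have "((\<lambda>t. ln ((norm (c t i - c t j))\<^sup>2)) has_real_derivative
        2 * ((v i - v j) \<bullet> (x i - x j)) / (norm (x i - x j))\<^sup>2) (at 0)"
      using ln_norm_squared_has_real_derivative[of "\<lambda>t. c t i - c t j" _ 0] ne c0 by simp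
    then have "((\<lambda>t. l i * l j * ln ((norm (c t i - c t j))\<^sup>2)) has_real_derivative
        l i * l j * (2 * ((v i - v j) \<bullet> (x i - x j)) / (norm (x i - x j))\<^sup>2)) (at 0)"
      by (rule DERIV_cmult)
    moreover have "(v i - v j) \<bullet> (x i - x j) = - (v i \<bullet> x j) - v j \<bullet> x i"
      using tangent[OF ij(1)] tangent[OF j] by (simp add: inner_diff)
    ultimately show ?thesis
      using ne
      by (simp add: a_def dist_norm norm_minus_commute[of "x j" "x i"] field_simps)
  qed
  then have "((\<lambda>t. hamiltonian N l (c t)) has_real_derivative
      (\<Sum>i = 1..2 * N. \<Sum>j\<in>{i<..2 * N}. a i j + a j i)) (at 0)"
    unfolding hamiltonian_def by (intro DERIV_sum)
  also have "(\<Sum>i = 1..2 * N. \<Sum>j\<in>{i<..2 * N}. a i j + a j i) = 0"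
    unfolding sum_pairs_eq_sum_off_diagonal a_def sum_distrib_left[symmetric]
    using balanced tangent by simp
  finally show "((\<lambda>t. hamiltonian N l (c t)) has_real_derivative 0) (at 0)" .
qed

section \<open>The equatorial ring\<close>

text \<open>
  Up to a vertical part, to which the equator is blind, \<open>v\<close> is a multiple of the eastward unit vector
  at longitude \<open>a\<close>; the factor is \<open>v $ 2 * cos a - v $ 1 * sin a\<close>.
\<close>

lemma equator_point_inner_tangent:
  assumes "v \<bullet> equator_point a = 0"
  shows "v \<bullet> equator_point b = (v $ 2 * cos a - v $ 1 * sin a) * sin (b - a)"
proof -
  have 0: "v $ 1 * cos a + v $ 2 * sin a = 0"
    using assms by (simp add: equator_point_def inner_vec_def sum_3)
  have "v \<bullet> equator_point b = v $ 1 * cos (a + (b - a)) + v $ 2 * sin (a + (b - a))"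
    by (simp add: equator_point_def inner_vec_def sum_3)
  also have "\<dots> = (v $ 1 * cos a + v $ 2 * sin a) * cos (b - a) +
      (v $ 2 * cos a - v $ 1 * sin a) * sin (b - a)"
    unfolding cos_add sin_add by (simp add: algebra_simps)
  finally show ?thesis
    using 0 by simp
qed

lemma dist_equator_point_squared:
  "(dist (equator_point a) (equator_point b))\<^sup>2 = 2 - 2 * cos (b - a)"
proof -
  have "(dist (equator_point a) (equator_point b))\<^sup>2 = (cos a - cos b)\<^sup>2 + (sin a - sin b)\<^sup>2"
    by (simp add: dist_norm power2_norm_eq_inner equator_point_def inner_vec_def sum_3
        power2_eq_square[symmetric])
  also have "\<dots> = ((sin a)\<^sup>2 + (cos a)\<^sup>2) + ((sin b)\<^sup>2 + (cos b)\<^sup>2) - 2 * cos (b - a)"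
    unfolding cos_diff by (simp add: power2_eq_square algebra_simps)
  finally show ?thesis
    by simp
qed

lemma equator_point_eq_iff:
  "equator_point a = equator_point b \<longleftrightarrow> (\<exists>n::int. a = b + 2 * pi * n)"
  by (auto simp: equator_point_def vec_eq_iff forall_3 sin_cos_eq_iff[symmetric])

lemma norm_equator_point [simp]: "norm (equator_point a) = 1"
  by (simp add: norm_eq_1 equator_point_def inner_vec_def sum_3 power2_eq_square[symmetric])

text \<open>
  The reflection \<open>\<sigma>\<close> fixing \<open>i\<close> reverses the angle to \<open>i\<close> up to full turns and keeps the parity of the
  label, so it changes the sign of every summand: the sum equals its own negative.
\<close>

lemma alternating_sum_reflection:
  fixes f :: "real \<Rightarrow> real"
  assumes "i < 2 * N" and odd: "\<And>s. f (- s) = - f s"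
    and periodic: "\<And>s n. f (s + 2 * pi * of_int n) = f s"
  shows "(\<Sum>k\<in>{..<2 * N} - {i}. (-1) ^ k * f (2 * pi * (real k - real i) / real (2 * N))) = 0"
proof -
  \<comment> \<open>The multiple \<open>2 * N\<close> keeps the subtraction of natural numbers from truncating.\<close>
  define \<sigma> where "\<sigma> k = (2 * i + 2 * N - k) mod (2 * N)" for k
  let ?g = "\<lambda>k. (-1) ^ k * f (2 * pi * (real k - real i) / real (2 * N))"
  have N: "N > 0" using assms(1) by simp
  have wrap: "\<exists>n::int. int (\<sigma> k) = 2 * int i - int k + 2 * int N * n" if "k < 2 * N" for k
  proof -
    have "int (\<sigma> k) = (2 * int i - int k + 2 * int N) mod (2 * int N)"
      using that by (simp add: \<sigma>_def of_nat_mod of_nat_diff algebra_simps)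
    then have "int (\<sigma> k) = 2 * int i - int k + 
        2 * int N * (1 - (2 * int i - int k + 2 * int N) div (2 * int N))"
      by (simp add: minus_mult_div_eq_mod[symmetric] algebra_simps)
    then show ?thesis by blast
  qed
  have lt: "\<sigma> k < 2 * N" for k
    using N by (simp add: \<sigma>_def)
  have eqI: "k = k'" if "k < 2 * N" "k' < 2 * N" "int k = int k' + 2 * int N * n" for k k' n
  proof -
    have "int k mod (2 * int N) = int k' mod (2 * int N)"
      using that(3) by simp
    then show ?thesis using that(1,2) by simp
  qed
  have invol: "\<sigma> (\<sigma> k) = k" if "k < 2 * N" for k
  proof -
    obtain n m where "int (\<sigma> k) = 2 * int i - int k + 2 * int N * n"
      "int (\<sigma> (\<sigma> k)) = 2 * int i - int (\<sigma> k) + 2 * int N * m"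
      using wrap[OF \<open>k < 2 * N\<close>] wrap[OF lt] by blast
    then have "int (\<sigma> (\<sigma> k)) = int k + 2 * int N * (m - n)"
      by (simp add: algebra_simps)
    then show ?thesis using eqI lt that by blast
  qed
  have fixed: "\<sigma> i = i"
    using assms(1) by (simp add: \<sigma>_def)
  have anti: "?g (\<sigma> k) = - ?g k" if "k < 2 * N" for k
  proof -
    obtain n where n: "int (\<sigma> k) = 2 * int i - int k + 2 * int N * n"
      using wrap[OF \<open>k < 2 * N\<close>] by blast
    have "even (int (\<sigma> k)) = even (int k)"
      unfolding n by simp
    then have par: "(-1 :: real) ^ \<sigma> k = (-1) ^ k"
      by (simp add: uminus_power_if)
    have "real_of_int (int (\<sigma> k)) = 2 * real i - real k + 2 * real N * n"
      unfolding n by simp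
    then have "real (\<sigma> k) - real i = - (real k - real i) + real (2 * N) * n"
      by simp
    then have "2 * pi * (real (\<sigma> k) - real i) / real (2 * N) =
        2 * pi * (- (real k - real i) + real (2 * N) * n) / real (2 * N)"
      by (simp only:)
    also have "\<dots> = - (2 * pi * (real k - real i) / real (2 * N)) + 2 * pi * of_int n"
      using N by (simp add: field_simps)
    finally have "2 * pi * (real (\<sigma> k) - real i) / real (2 * N) =
        - (2 * pi * (real k - real i) / real (2 * N)) + 2 * pi * of_int n" .
    then show ?thesis
      by (simp only: par odd periodic)
  qed
  have "bij_betw \<sigma> ({..<2 * N} - {i}) ({..<2 * N} - {i})"
  proof (rule bij_betwI[where g = \<sigma>])
    have "\<sigma> k \<noteq> i" if "k < 2 * N" "k \<noteq> i" for k
      using invol[OF that(1)] fixed that(2) by auto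
    then show "\<sigma> \<in> {..<2 * N} - {i} \<rightarrow> {..<2 * N} - {i}"
      "\<sigma> \<in> {..<2 * N} - {i} \<rightarrow> {..<2 * N} - {i}"
      using lt by auto
  qed (use invol in auto)
  then have "(\<Sum>k\<in>{..<2 * N} - {i}. ?g k) = (\<Sum>k\<in>{..<2 * N} - {i}. ?g (\<sigma> k))"
    by (rule sum.reindex_bij_betw[symmetric])
  also have "\<dots> = - (\<Sum>k\<in>{..<2 * N} - {i}. ?g k)"
    unfolding sum_negf[symmetric] by (rule sum.cong) (auto simp only: anti Diff_iff lessThan_iff)
  finally show ?thesis by simp
qed

lemma equatorial_pm_ring_fixed_equilibrium:
  assumes "equatorial_pm_ring N l x"
  shows "fixed_equilibrium N l x"
proof -
  obtain a p where p: "bij_betw p {..<2 * N} {1..2 * N}"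
    and xp: "\<And>k. k < 2 * N \<Longrightarrow> x (p k) = equator_point (a + 2 * pi * real k / real (2 * N))"
    and lp: "\<And>k. k < 2 * N \<Longrightarrow> l (p k) = (-1) ^ k"
    using assms unfolding equatorial_pm_ring_def by blast
  have label: "\<exists>k<2 * N. i = p k" if "i \<in> {1..2 * N}" for i
    using bij_betw_imp_surj_on[OF p] that by (metis imageE lessThan_iff)
  have inj: "k = m" if km: "k < 2 * N" "m < 2 * N" and eq: "x (p k) = x (p m)" for k m
  proof -
    obtain n :: int where n: "a + 2 * pi * real k / real (2 * N) =
        a + 2 * pi * real m / real (2 * N) + 2 * pi * n"
      using eq by (auto simp: xp km equator_point_eq_iff)
    have "2 * pi * real k = 2 * pi * (real m + real (2 * N) * n)"
      using n km by (simp add: field_simps)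
    then have "real_of_int (int k) = real_of_int (int m + int (2 * N) * n)"
      by simp
    then have "int k = int m + int (2 * N) * n"
      by (simp only: of_int_eq_iff)
    then have "int k mod int (2 * N) = int m mod int (2 * N)"
      by simp
    then show ?thesis
      using km by simp
  qed
  show ?thesis
  proof (rule fixed_equilibrium_if_balanced)
    show "x \<in> phase_space N"
    proof -
      have "norm (x i) = 1" if "i \<in> {1..2 * N}" for i
        using label[OF that] xp by auto
      moreover have "i = j" if "i \<in> {1..2 * N}" "j \<in> {1..2 * N}" "x i = x j" for i j
        using label[OF that(1)] label[OF that(2)] that(3) inj by blast
      ultimately show ?thesis
        unfolding phase_space_def by auto
    qed
  next
    fix i and v :: "real ^ 3"
    assume "i \<in> {1..2 * N}" and v: "v \<bullet> x i = 0"
    then obtain m where m: "m < 2 * N" and i: "i = p m"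
      using label by blast
    define C where "C = v $ 2 * cos (a + 2 * pi * real m / real (2 * N)) -
        v $ 1 * sin (a + 2 * pi * real m / real (2 * N))"
    define f where "f s = sin s / (2 - 2 * cos s)" for s :: real
    have "bij_betw p ({..<2 * N} - {m}) ({1..2 * N} - {i})"
      using bij_betw_DiffI[OF p, of "{m}" "{i}"] m \<open>i \<in> _\<close> by (simp add: i)
    then have "(\<Sum>j\<in>{1..2 * N} - {i}. l j * (v \<bullet> x j) / (dist (x i) (x j))\<^sup>2) =
        (\<Sum>k\<in>{..<2 * N} - {m}. l (p k) * (v \<bullet> x (p k)) / (dist (x i) (x (p k)))\<^sup>2)"
      by (rule sum.reindex_bij_betw[symmetric])
    also have "\<dots> = (\<Sum>k\<in>{..<2 * N} - {m}. C * ((-1) ^ k * f (2 * pi * (real k - real m) / real (2 * N))))"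
    proof (rule sum.cong[OF refl])
      fix k assume "k \<in> {..<2 * N} - {m}"
      then have k: "k < 2 * N" by simp
      have d: "(a + 2 * pi * real k / real (2 * N)) - (a + 2 * pi * real m / real (2 * N)) =
          2 * pi * (real k - real m) / real (2 * N)"
        by (simp add: diff_divide_distrib right_diff_distrib)
      have "v \<bullet> x (p k) = C * sin (2 * pi * (real k - real m) / real (2 * N))"
        using equator_point_inner_tangent[OF v[unfolded i xp[OF m]]]
        unfolding xp[OF k] C_def d[symmetric] by blast
      then show "l (p k) * (v \<bullet> x (p k)) / (dist (x i) (x (p k)))\<^sup>2 =
          C * ((-1) ^ k * f (2 * pi * (real k - real m) / real (2 * N)))"
        by (simp only: i xp[OF k] xp[OF m] lp[OF k] dist_equator_point_squared d f_def) simp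
    qed
    also have "\<dots> = 0"
    proof -
      have "f (s + 2 * pi * of_int n) = f s" for s n
        by (simp add: f_def sin_add cos_add)
      then show ?thesis
        unfolding sum_distrib_left[symmetric]
        by (subst alternating_sum_reflection[OF m]) (auto simp: f_def)
    qed
    finally show "(\<Sum>j\<in>{1..2 * N} - {i}. l j * (v \<bullet> x j) / (dist (x i) (x j))\<^sup>2) = 0" .
  qed
qed

section \<open>The tetrahedron and its dual\<close>

lemma dist_unit_squared:
  fixes u v :: "'a::real_inner"
  assumes "norm u = 1" "norm v = 1"
  shows "(dist u v)\<^sup>2 = 2 - 2 * (u \<bullet> v)"
  using assms by (simp add: dist_norm power2_norm_eq_inner inner_diff norm_eq_1 inner_commute)

lemma regular_tetrahedron_constant_inner:
  assumes T: "regular_tetrahedron_on_sphere T"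
  obtains c where "c < 1" and "\<And>u v. u \<in> T \<Longrightarrow> v \<in> T \<Longrightarrow> u \<noteq> v \<Longrightarrow> u \<bullet> v = c"
proof -
  obtain d where d: "\<And>u v. u \<in> T \<Longrightarrow> v \<in> T \<Longrightarrow> u \<noteq> v \<Longrightarrow> dist u v = d"
    and unit: "\<And>u. u \<in> T \<Longrightarrow> norm u = 1" and card: "card T = 4"
    using T unfolding regular_tetrahedron_on_sphere_def by (auto simp: subset_iff)
  have "\<not> card T \<le> Suc 0" using card by simp
  then obtain u v where uv: "u \<in> T" "v \<in> T" "u \<noteq> v"
    using card card_le_Suc0_iff_eq[of T] by (metis card.infinite zero_le)
  then have "d > 0" using d by (metis zero_less_dist_iff)
  show thesis
  proof (rule that)
    show "1 - d\<^sup>2 / 2 < 1" using \<open>d > 0\<close> by simp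
    show "u \<bullet> v = 1 - d\<^sup>2 / 2" if "u \<in> T" "v \<in> T" "u \<noteq> v" for u v
      using dist_unit_squared[OF unit[OF that(1)] unit[OF that(2)]] d[OF that]
      by (simp add: field_simps)
  qed
qed

text \<open>
  Four vectors of a three-dimensional space admit a nontrivial relation with coefficients \<open>b\<close>. Taking
  its inner product with a vertex \<open>w\<close> gives \<open>(1 - c) * b w + c * B = 0\<close>, where \<open>B\<close> is the sum of all
  coefficients and \<open>c\<close> the common inner product of distinct vertices. As \<open>c < 1\<close>, all coefficients are equal, and the relation is a multiple of the sum of
  the vertices.
\<close>

lemma regular_tetrahedron_sum_eq_0:
  assumes T: "regular_tetrahedron_on_sphere T"
  shows "\<Sum>T = 0"
proof -
  obtain c where c: "c < 1" "\<And>u v. u \<in> T \<Longrightarrow> v \<in> T \<Longrightarrow> u \<noteq> v \<Longrightarrow> u \<bullet> v = c"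
    using regular_tetrahedron_constant_inner[OF T] by blast
  have card: "card T = 4" and unit: "\<And>u. u \<in> T \<Longrightarrow> norm u = 1"
    using T unfolding regular_tetrahedron_on_sphere_def by (auto simp: subset_iff)
  have fin: "finite T"
    using card by (metis card.infinite zero_neq_numeral)
  have "dependent T"
    by (rule dependent_biggerset) (simp_all add: card fin)
  then obtain b where b: "(\<Sum>u\<in>T. b u *\<^sub>R u) = 0" and nz: "\<exists>u\<in>T. b u \<noteq> 0"
    using dependent_finite[OF fin] by blast
  define B where "B = sum b T"
  have coeff: "(1 - c) * b w = - c * B" if w: "w \<in> T" for w
  proof -
    have "0 = (\<Sum>u\<in>T. b u * (u \<bullet> w))"
      using arg_cong[OF b, of "\<lambda>z. z \<bullet> w"] by (simp add: inner_sum_left)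
    also have "\<dots> = b w * (w \<bullet> w) + (\<Sum>u\<in>T - {w}. b u * (u \<bullet> w))"
      using fin w by (rule sum.remove)
    also have "(\<Sum>u\<in>T - {w}. b u * (u \<bullet> w)) = (\<Sum>u\<in>T - {w}. b u) * c"
      unfolding sum_distrib_right by (rule sum.cong) (use c(2) w in auto)
    also have "(\<Sum>u\<in>T - {w}. b u) = B - b w"
      using fin w by (simp add: B_def sum_diff1)
    finally show ?thesis
      using unit[OF w] by (simp add: norm_eq_1 algebra_simps)
  qed
  obtain w where w: "w \<in> T" "b w \<noteq> 0" using nz by blast
  have "b u = b w" if "u \<in> T" for u
    using coeff[OF that] coeff[OF w(1)] c(1) by (metis diff_gt_0_iff_gt less_irrefl mult_left_cancel)
  then have "b w *\<^sub>R \<Sum>T = 0"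
    using b by (simp add: scaleR_sum_right)
  then show ?thesis using w(2) by simp
qed

text \<open>
  If two vertices were antipodal, all inner products of distinct vertices would be \<open>-1\<close>, whereas the
  vanishing of the vertex sum, paired with a vertex, says that three of them add up to \<open>-1\<close>.
\<close>

lemma regular_tetrahedron_neg_disjoint:
  assumes T: "regular_tetrahedron_on_sphere T" and "u \<in> T" "v \<in> T"
  shows "u \<noteq> - v"
proof
  assume uv: "u = - v"
  obtain c where "c < 1" and c: "\<And>u v. u \<in> T \<Longrightarrow> v \<in> T \<Longrightarrow> u \<noteq> v \<Longrightarrow> u \<bullet> v = c"
    using regular_tetrahedron_constant_inner[OF T] by blast
  have card: "card T = 4" and unit: "\<And>u. u \<in> T \<Longrightarrow> norm u = 1"
    using T unfolding regular_tetrahedron_on_sphere_def by (auto simp: subset_iff)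
  have fin: "finite T"
    using card by (metis card.infinite zero_neq_numeral)
  have vv: "v \<bullet> v = 1" using unit[OF assms(3)] by (simp add: norm_eq_1)
  have "u \<noteq> v"
  proof
    assume "u = v"
    then have "v \<bullet> v = - (v \<bullet> v)" using uv by (metis inner_minus_left)
    then show False using vv by simp
  qed
  then have c1: "c = - 1" using c[OF assms(2,3)] vv uv by simp
  have "0 = \<Sum>T \<bullet> v" by (simp add: regular_tetrahedron_sum_eq_0[OF T])
  also have "\<dots> = v \<bullet> v + (\<Sum>u\<in>T - {v}. u \<bullet> v)"
    unfolding inner_sum_left using fin assms(3) by (rule sum.remove)
  also have "(\<Sum>u\<in>T - {v}. u \<bullet> v) = (\<Sum>u\<in>T - {v}. c)"
    by (rule sum.cong) (use c assms(3) in auto)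
  finally show False
    using vv c1 card fin assms(3) by simp
qed

lemma regular_tetrahedron_dual:
  assumes "regular_tetrahedron_on_sphere T"
  shows "regular_tetrahedron_on_sphere (dual_tetrahedron T)"
  using assms unfolding regular_tetrahedron_on_sphere_def dual_tetrahedron_def
  by (auto simp: card_image dist_minus)

text \<open>
  Each tetrahedron balances separately at a vertex \<open>w\<close> of the first one, whatever the relative
  strength of the two groups. With \<open>c\<close> the common inner product of distinct vertices, the squared
  distances to the dual are \<open>2 + 2 * c\<close>, except for the antipode of \<open>w\<close>, whose summand has numerator
  zero.
\<close>

lemma regular_tetrahedron_balanced:
  assumes T: "regular_tetrahedron_on_sphere T" and w: "w \<in> T" and v: "v \<bullet> w = 0"
  shows "(\<Sum>u\<in>T - {w}. (v \<bullet> u) / (dist w u)\<^sup>2) = 0"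
    and "(\<Sum>u\<in>dual_tetrahedron T. (v \<bullet> u) / (dist w u)\<^sup>2) = 0"
proof -
  obtain c where "c < 1" and c: "\<And>u v. u \<in> T \<Longrightarrow> v \<in> T \<Longrightarrow> u \<noteq> v \<Longrightarrow> u \<bullet> v = c"
    using regular_tetrahedron_constant_inner[OF T] by blast
  have card: "card T = 4" and unit: "\<And>u. u \<in> T \<Longrightarrow> norm u = 1"
    using T unfolding regular_tetrahedron_on_sphere_def by (auto simp: subset_iff)
  have fin: "finite T"
    using card by (metis card.infinite zero_neq_numeral)
  have "0 = v \<bullet> \<Sum>T" by (simp add: regular_tetrahedron_sum_eq_0[OF T])
  also have "\<dots> = v \<bullet> w + (\<Sum>u\<in>T - {w}. v \<bullet> u)"
    unfolding inner_sum_right using fin w by (rule sum.remove)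
  finally have others: "(\<Sum>u\<in>T - {w}. v \<bullet> u) = 0"
    using v by simp
  have "(\<Sum>u\<in>T - {w}. (v \<bullet> u) / (dist w u)\<^sup>2) = (\<Sum>u\<in>T - {w}. (v \<bullet> u) / (2 - 2 * c))"
    by (rule sum.cong) (use w unit c in \<open>auto simp: dist_unit_squared\<close>)
  then show "(\<Sum>u\<in>T - {w}. (v \<bullet> u) / (dist w u)\<^sup>2) = 0"
    by (simp add: sum_divide_distrib[symmetric] others)
  have "(\<Sum>u\<in>dual_tetrahedron T. (v \<bullet> u) / (dist w u)\<^sup>2) = (\<Sum>u\<in>T. (v \<bullet> - u) / (dist w (- u))\<^sup>2)"
    unfolding dual_tetrahedron_def by (subst sum.reindex) auto
  also have "\<dots> = (v \<bullet> - w) / (dist w (- w))\<^sup>2 + (\<Sum>u\<in>T - {w}. (v \<bullet> - u) / (dist w (- u))\<^sup>2)"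
    using fin w by (rule sum.remove)
  also have "(\<Sum>u\<in>T - {w}. (v \<bullet> - u) / (dist w (- u))\<^sup>2) = (\<Sum>u\<in>T - {w}. - (v \<bullet> u) / (2 + 2 * c))"
    by (rule sum.cong) (use w unit c in \<open>auto simp: dist_unit_squared\<close>)
  also have "\<dots> = 0"
    by (simp add: sum_divide_distrib[symmetric] sum_negf others)
  finally show "(\<Sum>u\<in>dual_tetrahedron T. (v \<bullet> u) / (dist w u)\<^sup>2) = 0"
    using v by simp
qed

text \<open>
  The dual of the dual is the original tetrahedron, so a negative vortex is treated as a positive one
  with the two tetrahedra exchanged.
\<close>

lemma tetrahedron_and_dual_fixed_equilibrium:
  assumes "vorticities 4 l" and "tetrahedron_and_dual l x"
  shows "fixed_equilibrium 4 l x"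
proof (rule fixed_equilibrium_if_balanced)
  define P where "P = {i \<in> {1..8::nat}. l i = 1}"
  define M where "M = {i \<in> {1..8::nat}. l i = -1}"
  obtain T where T: "regular_tetrahedron_on_sphere T"
    and P: "bij_betw x P T" and M: "bij_betw x M (dual_tetrahedron T)"
    using assms(2) unfolding tetrahedron_and_dual_def P_def M_def by blast
  let ?D = "dual_tetrahedron T"
  have D: "regular_tetrahedron_on_sphere ?D"
    using T by (rule regular_tetrahedron_dual)
  have DD: "dual_tetrahedron ?D = T"
    by (simp add: dual_tetrahedron_def image_image)
  have labels: "{1..8} = P \<union> M" "P \<inter> M = {}" "finite P" "finite M"
    using assms(1) by (auto simp: vorticities_def P_def M_def)
  have disj: "T \<inter> ?D = {}"
    using regular_tetrahedron_neg_disjoint[OF T] by (auto simp: dual_tetrahedron_def)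
  have bij: "bij_betw x {1..8} (T \<union> ?D)"
    unfolding labels(1) using P M disj by (rule bij_betw_combine)
  have "T \<union> ?D \<subseteq> sphere 0 1"
    using T D by (simp add: regular_tetrahedron_on_sphere_def)
  then have "x i \<in> sphere 0 1" if "i \<in> {1..8}" for i
    using bij_betwE[OF bij] that by blast
  then show "x \<in> phase_space 4"
    using bij_betw_imp_inj_on[OF bij] unfolding phase_space_def inj_on_def by auto
  have balanced: "(\<Sum>j\<in>A - {i}. (v \<bullet> x j) / (dist (x i) (x j))\<^sup>2) = 0 \<and>
      (\<Sum>j\<in>B. (v \<bullet> x j) / (dist (x i) (x j))\<^sup>2) = 0"
    if S: "regular_tetrahedron_on_sphere S" and A: "bij_betw x A S"
      and B: "bij_betw x B (dual_tetrahedron S)" and i: "i \<in> A" and v: "v \<bullet> x i = 0"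
    for S A B i v
  proof -
    have xi: "x i \<in> S" using A i by (rule bij_betwE[rule_format])
    have "bij_betw x (A - {i}) (S - {x i})"
      using bij_betw_DiffI[OF A, of "{i}" "{x i}"] i xi by simp
    from sum.reindex_bij_betw[OF this, of "\<lambda>u. (v \<bullet> u) / (dist (x i) u)\<^sup>2"]
      sum.reindex_bij_betw[OF B, of "\<lambda>u. (v \<bullet> u) / (dist (x i) u)\<^sup>2"]
    show ?thesis
      using regular_tetrahedron_balanced[OF S xi v] by simp
  qed
  fix i and v :: "real ^ 3"
  assume i: "i \<in> {1..2 * 4}" and v: "v \<bullet> x i = 0"
  let ?t = "\<lambda>j. (v \<bullet> x j) / (dist (x i) (x j))\<^sup>2"
  have "(\<Sum>j\<in>{1..2 * 4} - {i}. l j * (v \<bullet> x j) / (dist (x i) (x j))\<^sup>2) =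
      (\<Sum>j\<in>(P - {i}) \<union> (M - {i}). l j * ?t j)"
    by (rule sum.cong) (use labels(1) in auto)
  also have "\<dots> = (\<Sum>j\<in>P - {i}. l j * ?t j) + (\<Sum>j\<in>M - {i}. l j * ?t j)"
    by (rule sum.union_disjoint) (use labels in auto)
  also have "(\<Sum>j\<in>P - {i}. l j * ?t j) = (\<Sum>j\<in>P - {i}. ?t j)"
    by (rule sum.cong) (auto simp: P_def)
  also have "(\<Sum>j\<in>M - {i}. l j * ?t j) = - (\<Sum>j\<in>M - {i}. ?t j)"
    unfolding sum_negf[symmetric] by (rule sum.cong) (auto simp: M_def)
  finally have split: "(\<Sum>j\<in>{1..2 * 4} - {i}. l j * (v \<bullet> x j) / (dist (x i) (x j))\<^sup>2) =
      (\<Sum>j\<in>P - {i}. ?t j) + - (\<Sum>j\<in>M - {i}. ?t j)" .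
  have "(\<Sum>j\<in>P - {i}. ?t j) = 0 \<and> (\<Sum>j\<in>M - {i}. ?t j) = 0"
  proof (cases "i \<in> P")
    case True
    then have "M - {i} = M" using labels by auto
    then show ?thesis using balanced[OF T P M True v] by simp
  next
    case False
    then have iM: "i \<in> M" and "P - {i} = P" using i labels by auto
    then show ?thesis using balanced[OF D M _ iM v, of P] P DD by simp
  qed
  then show "(\<Sum>j\<in>{1..2 * 4} - {i}. l j * (v \<bullet> x j) / (dist (x i) (x j))\<^sup>2) = 0"
    using split by simp
qed

theorem proposition3p2:
  "(\<forall>N l x. N \<ge> 2 \<longrightarrow> vorticities N l \<longrightarrow> equatorial_pm_ring N l x \<longrightarrow> fixed_equilibrium N l x) \<and>
   (\<forall>l x. vorticities 4 l \<longrightarrow> tetrahedron_and_dual l x \<longrightarrow> fixed_equilibrium 4 l x)"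
  using equatorial_pm_ring_fixed_equilibrium tetrahedron_and_dual_fixed_equilibrium by blast

end
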